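(* Let $\varepsilon\in(0,1/2)$, let $k\ge 1$ be an integer, let $C>0$, and let rational workers, all having the same effort function $f$, be organized into a supervision tree with branching factor $k$ and penalty cost $C$. If $$C\ \ge\ \frac{f'(\varepsilon)\,k}{2\varepsilon-1},$$ then in every Nash equilibrium every worker plays truthfully, i.e. every worker's chosen error probability is strictly less than $\varepsilon$.
   Context: Effort function: a function $f:(0,1]\to[0,+\infty)$ that is monotonically decreasing, differentiable and strictly convex; performing a task with error probability $e$ (probability of reporting an incorrect solution) costs effort $f(e)$. Supervision tree of depth $L$: a rooted tree whose leaves are tasks (all at level $L-1$), whose internal nodes other than the root are workers, and whose root (level $0$) is the supervisor. Workers at level $L-2$ perform the tasks they are connected to; every node at level $0\le l<L-2$ performs exactly one task in common with each of its children. Branching factor $k$: each worker has $k$ children and performs $k$ tasks. Each worker is penalized by its parent: on the shared task, the worker pays $C$ if its solution differs from the parent's and $0$ otherwise. The errors of a worker and its parent are independent. Game: each worker $u$ chooses an error probability $e_u\in(0,1]$. The supervisor plays a fixed truthful strategy, i.e. has a fixed error probability $e_0\in[0,\varepsilon)$. If $w$ is the parent of $u$, with error probability $e_w$, the expected loss that $u$ wishes to minimize is $$L(e_u,e_w)=k f(e_u)+e_u(1-e_w)C+(1-e_u)e_wC+e_ue_wD,$$ where $D\in[0,C]$ is a constant (the expected penalty when both are wrong). A Nash equilibrium is a profile $(e_u)_u$ in which each $e_u$ minimizes $L(\cdot,e_w)$ over $(0,1]$, with $w$ the parent of $u$. A strategy $e$ is truthful if $e<\varepsilon$. *)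

theory Defs
  imports "HOL-Analysis.Analysis"
begin

definition strictly_convex_on :: "real set \<Rightarrow> (real \<Rightarrow> real) \<Rightarrow> bool" where
  "strictly_convex_on S f \<longleftrightarrow> convex S \<and>
     (\<forall>x\<in>S. \<forall>y\<in>S. \<forall>t. x \<noteq> y \<and> 0 < t \<and> t < 1 \<longrightarrow>
        f ((1 - t) * x + t * y) < (1 - t) * f x + t * f y)"

(* Only the values on (0,1] matter; at the endpoint 1 differentiability is one-sided. *)
definition effort_function :: "(real \<Rightarrow> real) \<Rightarrow> bool" where
  "effort_function f \<longleftrightarrow>
     (\<forall>x\<in>{0<..1}. 0 \<le> f x) \<and>
     antimono_on {0<..1} f \<and>
     f differentiable_on {0<..1} \<and>
     strictly_convex_on {0<..1} f"

(* The parent of the root is irrelevant.  performs v is the set of tasks (which are nodes, namely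
   leaves) performed by the internal node v. *)
record 'v org =
  nodes :: "'v set"
  root :: 'v
  parent :: "'v \<Rightarrow> 'v"
  performs :: "'v \<Rightarrow> 'v set"

definition rooted_tree :: "('v, 'z) org_scheme \<Rightarrow> bool" where
  "rooted_tree T \<longleftrightarrow>
     finite (nodes T) \<and> root T \<in> nodes T \<and>
     (\<forall>v \<in> nodes T - {root T}. parent T v \<in> nodes T) \<and>
     (\<forall>v \<in> nodes T. \<exists>n. (parent T ^^ n) v = root T)"

definition level :: "('v, 'z) org_scheme \<Rightarrow> 'v \<Rightarrow> nat" where
  "level T v = (LEAST n. (parent T ^^ n) v = root T)"

definition children :: "('v, 'z) org_scheme \<Rightarrow> 'v \<Rightarrow> 'v set" where
  "children T v = {u \<in> nodes T - {root T}. parent T u = v}"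

definition task_nodes :: "('v, 'z) org_scheme \<Rightarrow> 'v set" where
  "task_nodes T = {v \<in> nodes T. children T v = {}}"

definition workers :: "('v, 'z) org_scheme \<Rightarrow> 'v set" where
  "workers T = nodes T - task_nodes T - {root T}"

(* Levels range over 0, ..., L - 1; L \<ge> 2 makes the root an internal node.  Neither the number of
   children of the supervisor nor the number of tasks it performs is prescribed. *)
definition supervision_tree :: "('v, 'z) org_scheme \<Rightarrow> nat \<Rightarrow> nat \<Rightarrow> bool" where
  "supervision_tree T L k \<longleftrightarrow>
     rooted_tree T \<and> L \<ge> 2 \<and>
     (\<forall>v \<in> task_nodes T. level T v = L - 1) \<and>
     (\<forall>v \<in> nodes T - task_nodes T. performs T v \<subseteq> task_nodes T) \<and>
     (\<forall>v \<in> nodes T. level T v = L - 2 \<longrightarrow> performs T v = children T v) \<and>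
     (\<forall>v \<in> nodes T. level T v < L - 2 \<longrightarrow>
        (\<forall>u \<in> children T v. card (performs T v \<inter> performs T u) = 1)) \<and>
     (\<forall>v \<in> workers T. card (children T v) = k \<and> card (performs T v) = k)"

(* The errors of a worker (probability x) and of its parent (probability y) are independent.  If
   exactly one of them is wrong, the solutions differ and the penalty is C; D is the expected
   penalty when both are wrong, since two wrong solutions may or may not agree. *)
definition expected_loss ::
  "nat \<Rightarrow> (real \<Rightarrow> real) \<Rightarrow> real \<Rightarrow> real \<Rightarrow> real \<Rightarrow> real \<Rightarrow> real" where
  "expected_loss k f C D x y =
     real k * f x + x * (1 - y) * C + (1 - x) * y * C + x * y * D"

(* The supervisor is not a player: its error probability e0 is fixed. *)
definition nash_equilibrium ::
  "('v, 'z) org_scheme \<Rightarrow> nat \<Rightarrow> (real \<Rightarrow> real) \<Rightarrow> real \<Rightarrow> real \<Rightarrow> real \<Rightarrow>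
    ('v \<Rightarrow> real) \<Rightarrow> bool" where
  "nash_equilibrium T k f C D e0 e \<longleftrightarrow>
     e (root T) = e0 \<and>
     (\<forall>u \<in> workers T.
        is_arg_min (\<lambda>x. expected_loss k f C D x (e (parent T u))) (\<lambda>x. x \<in> {0<..1}) (e u))"

definition truthful :: "real \<Rightarrow> real \<Rightarrow> bool" where
  "truthful \<epsilon> x \<longleftrightarrow> x < \<epsilon>"

end

theory Submission
  imports Defs
begin

text \<open>The loss of a worker is convex in its own error probability, and its slope at \<open>\<epsilon>\<close> is
  \<open>k f'(\<epsilon>) + (1 - 2 y) C + y D\<close>, where \<open>y\<close> is the error probability of the parent. If \<open>0 \<le> y < \<epsilon>\<close>,
  the bound on \<open>C\<close> makes this slope positive, so every minimizer lies strictly to the left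
  of \<open>\<epsilon>\<close>. Truthfulness therefore propagates from the supervisor down the tree.\<close>

lemma strictly_convex_on_imp_convex_on:
  assumes "strictly_convex_on S f"
  shows "convex_on S f"
proof (rule convex_onI)
  fix t x y :: real
  assume "0 < t" "t < 1" "x \<in> S" "y \<in> S"
  then show "f ((1 - t) *\<^sub>R x + t *\<^sub>R y) \<le> (1 - t) * f x + t * f y"
    using assms
    by (cases "x = y") (auto simp: strictly_convex_on_def less_imp_le scaleR_left_distrib[symmetric]
        distrib_right[symmetric])
qed (use assms in \<open>simp add: strictly_convex_on_def\<close>)

text \<open>A convex function lies above its tangent at \<open>a\<close>. With positive slope, a
  point to the right of \<open>a\<close> therefore has a larger value than \<open>a\<close>, and
  \<open>a\<close> itself, being interior, is not a minimizer.\<close>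

lemma convex_arg_min_less:
  fixes g :: "real \<Rightarrow> real"
  assumes convex: "convex_on S g" and "connected S"
    and a: "a \<in> interior S"
    and deriv: "(g has_real_derivative d) (at a)" and "d > 0"
    and min: "is_arg_min g (\<lambda>x. x \<in> S) m"
  shows "m < a"
proof (rule ccontr)
  assume "\<not> m < a"
  have m: "m \<in> S" and least: "\<And>x. x \<in> S \<Longrightarrow> g m \<le> g x"
    using min by (auto simp: is_arg_min_linorder)
  have "(g has_real_derivative d) (at a within S)"
    using deriv by (rule has_field_derivative_at_within)
  then have "g m - g a \<ge> d * (m - a)"
    by (rule convex_on_imp_above_tangent[OF convex \<open>connected S\<close> a m])
  moreover have "g m \<le> g a"
    using a interior_subset least by blast
  ultimately have "d * (m - a) \<le> 0"
    by linarith
  with \<open>\<not> m < a\<close> \<open>d > 0\<close> have "m = a"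
    by (simp add: mult_le_0_iff)
  \<comment> \<open>At \<open>m = a\<close> the tangent inequality is void; instead, an interior
    minimum forces the derivative to vanish.\<close>
  obtain \<delta> where "\<delta> > 0" and \<delta>: "ball a \<delta> \<subseteq> S"
    using a by (auto simp: mem_interior)
  have "\<bar>a - y\<bar> < \<delta> \<Longrightarrow> g a \<le> g y" for y
    using \<delta> least \<open>m = a\<close> by (auto simp: dist_real_def subset_iff)
  then have "d = 0"
    using DERIV_local_min[OF deriv \<open>\<delta> > 0\<close>] by blast
  with \<open>d > 0\<close> show False
    by simp
qed

lemma best_response_truthful:
  fixes \<epsilon> C D y :: real
  assumes \<epsilon>: "0 < \<epsilon>" "\<epsilon> < 1/2"
    and "C > 0" "0 \<le> D"
    and f: "effort_function f"
    and "0 \<le> y" "truthful \<epsilon> y"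
    and C: "C \<ge> deriv f \<epsilon> * real k / (2 * \<epsilon> - 1)"
    and min: "is_arg_min (\<lambda>x. expected_loss k f C D x y) (\<lambda>x. x \<in> {0<..1}) m"
  shows "truthful \<epsilon> m"
proof -
  define d where "d = real k * deriv f \<epsilon> + ((1 - 2 * y) * C + y * D)"
  define g where "g = (\<lambda>x. expected_loss k f C D x y)"
  \<comment> \<open>For fixed \<open>y\<close> the expected penalty is affine in \<open>x\<close>,
    so convexity of the loss comes from \<open>f\<close> alone.\<close>
  have g_eq: "g = (\<lambda>x. real k * f x + (((1 - 2 * y) * C + y * D) * x + y * C))"
    by (auto simp: g_def expected_loss_def algebra_simps)
  \<comment> \<open>Differentiability is only given within (0,1]; at an interior point it is
    two-sided, so \<open>deriv f \<epsilon>\<close> is a genuine derivative.\<close>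
  have interior: "\<epsilon> \<in> interior {0<..1}"
    using \<epsilon> by (intro interiorI[of "{0<..<1}"]) auto
  have "f differentiable (at \<epsilon> within {0<..1})"
    using f \<epsilon> by (auto simp: effort_function_def differentiable_on_def)
  then have "f differentiable (at \<epsilon>)"
    by (simp add: at_within_interior[OF interior])
  then have "(f has_real_derivative deriv f \<epsilon>) (at \<epsilon>)"
    by (simp add: DERIV_deriv_iff_real_differentiable)
  then have deriv: "(g has_real_derivative d) (at \<epsilon>)"
    unfolding g_eq d_def by (auto intro!: derivative_eq_intros)
  have "convex_on {0<..1} f"
    using f by (auto simp: effort_function_def intro: strictly_convex_on_imp_convex_on)
  moreover have "convex_on {0<..1} (\<lambda>x. ((1 - 2 * y) * C + y * D) * x + y * C)"
    by (rule convex_onI) (simp_all add: algebra_simps)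
  ultimately have convex: "convex_on {0<..1} g"
    unfolding g_eq by (rule convex_on_add[OF convex_on_cmul, rotated]) simp_all
  \<comment> \<open>The denominator \<open>2 * \<epsilon> - 1\<close> is negative, so clearing it
    reverses the inequality. Strictness enters next, from \<open>y < \<epsilon>\<close>.\<close>
  have "- (real k * deriv f \<epsilon>) \<le> (1 - 2 * \<epsilon>) * C"
    using C \<epsilon> by (simp add: divide_le_eq algebra_simps)
  also have "\<dots> < (1 - 2 * y) * C"
    using \<open>truthful \<epsilon> y\<close> \<open>C > 0\<close> by (simp add: truthful_def)
  also have "\<dots> \<le> (1 - 2 * y) * C + y * D"
    using \<open>0 \<le> y\<close> \<open>0 \<le> D\<close> by simp
  finally have "d > 0"
    by (simp add: d_def)
  have "m < \<epsilon>"
    using convex_arg_min_less[OF convex _ interior deriv \<open>d > 0\<close>] min by (simp add: g_def)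
  then show ?thesis
    by (simp add: truthful_def)
qed

text \<open>The parent has \<open>u\<close> as a child, hence is not a leaf.\<close>

lemma parent_of_worker:
  assumes "rooted_tree T" "u \<in> workers T"
  shows "parent T u \<in> insert (root T) (workers T)"
proof -
  have "u \<in> nodes T - {root T}"
    using assms(2) by (auto simp: workers_def)
  moreover from this have "parent T u \<in> nodes T"
    using assms(1) by (auto simp: rooted_tree_def)
  ultimately show ?thesis
    by (auto simp: workers_def task_nodes_def children_def)
qed

text \<open>Induction on the number of \<open>parent\<close> steps to the root. The root is not a
  worker, so \<open>P\<close> is never claimed for it; it appears as a separate case for the
  parent.\<close>

lemma worker_induct [consumes 2, case_names step]:
  assumes tree: "rooted_tree T" and "u \<in> workers T"
    and step: "\<And>u. u \<in> workers T \<Longrightarrow> parent T u = root T \<or> parent T u \<in> workers T \<and> P (parent T u)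
      \<Longrightarrow> P u"
  shows "P u"
proof -
  obtain n where "(parent T ^^ n) u = root T"
    using assms by (auto simp: rooted_tree_def workers_def)
  then show ?thesis
    using \<open>u \<in> workers T\<close>
  proof (induction n arbitrary: u)
    case 0
    then show ?case
      by (simp add: workers_def)
  next
    case (Suc n)
    then have "(parent T ^^ n) (parent T u) = root T"
      by (simp add: funpow_swap1)
    then show ?case
      using step[OF Suc.prems(2)] parent_of_worker[OF tree Suc.prems(2)] Suc.IH by blast
  qed
qed

theorem theorem3:
  fixes \<epsilon> C D e0 :: real and k L :: nat and f :: "real \<Rightarrow> real"
    and T :: "'v org" and e :: "'v \<Rightarrow> real"
  assumes "0 < \<epsilon>" and "\<epsilon> < 1/2"
    and "k \<ge> 1"
    and "C > 0"
    and "0 \<le> D" and "D \<le> C"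
    and "effort_function f"
    and "supervision_tree T L k"
    and "0 \<le> e0" and "truthful \<epsilon> e0"
    and "C \<ge> deriv f \<epsilon> * real k / (2 * \<epsilon> - 1)"
    and "nash_equilibrium T k f C D e0 e"
  shows "\<forall>u \<in> workers T. truthful \<epsilon> (e u)"
proof
  have root: "e (root T) = e0"
    using assms(12) by (simp add: nash_equilibrium_def)
  have best: "is_arg_min (\<lambda>x. expected_loss k f C D x (e (parent T v))) (\<lambda>x. x \<in> {0<..1}) (e v)"
      if "v \<in> workers T" for v
    using assms(12) that by (auto simp: nash_equilibrium_def)
  fix u assume u: "u \<in> workers T"
  have "rooted_tree T"
    using assms(8) by (simp add: supervision_tree_def)
  then show "truthful \<epsilon> (e u)"
    using u
  proof (induction rule: worker_induct)
    case (step u)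
    \<comment> \<open>\<open>truthful\<close> bounds an error probability only from above; the lower
      bound comes from the strategy set (0,1].\<close>
    have "0 \<le> e v" if "v \<in> workers T" for v
      using best[OF that] by (simp add: is_arg_min_def)
    then have "0 \<le> e (parent T u)" "truthful \<epsilon> (e (parent T u))"
      using step(2) root assms(9,10) by auto
    then show ?case
      by (rule best_response_truthful[OF assms(1,2,4,5,7) _ _ assms(11) best[OF step(1)]])
  qed
qed

end
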